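(* Let $a,b>0$ and $v\in[0,1]$. Then $$a\sharp_v b\leq\Big(a\sharp_{\frac{v}{2}}b\Big)\nabla_v\Big(a\sharp_{\frac{1+v}{2}}b\Big)\leq L_v(a,b)\leq(a\sharp_v b)\nabla(a\nabla_v b)\leq a\nabla_v b$$ and $$a\sharp_v b\leq\big(a\nabla_v b\big)\sharp\big(a\sharp_v b\big)\leq I_v(a,b)\leq\big(a\nabla_{\frac{v}{2}}b\big)\sharp_v\big(a\nabla_{\frac{1+v}{2}}b\big)\leq a\nabla_v b.$$
   Context: For $a,b>0$ and $v\in[0,1]$: $a\nabla_v b=(1-v)a+vb$ and $a\sharp_v b=a^{1-v}b^v$; for $v=1/2$ write $a\nabla b=\frac{a+b}{2}$ and $a\sharp b=\sqrt{ab}$. The weighted logarithmic mean $L_v$ and the weighted identric mean $I_v$ are defined, for $a\ne b$ and $v\in(0,1)$, by $$L_v(a,b)=\frac{1}{\log a-\log b}\left(\frac{1-v}{v}\big(a-a^{1-v}b^v\big)+\frac{v}{1-v}\big(a^{1-v}b^v-b\big)\right),$$ $$I_v(a,b)=\frac1e\,\big(a\nabla_v b\big)^{\frac{(1-2v)(a\nabla_v b)}{v(1-v)(b-a)}}\left(\frac{b^{\frac{vb}{1-v}}}{a^{\frac{(1-v)a}{v}}}\right)^{\frac1{b-a}},$$ with the limit values $L_0(a,b)=I_0(a,b)=a$, $L_1(a,b)=I_1(a,b)=b$, and $L_v(a,a)=I_v(a,a)=a$. *)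

theory Defs
  imports Complex_Main
begin

definition weighted_arith_mean :: "real \<Rightarrow> real \<Rightarrow> real \<Rightarrow> real"
    ("(_ \<nabla>\<^bsub>_\<^esub> _)" [71, 0, 71] 70)
  where "a \<nabla>\<^bsub>v\<^esub> b = (1 - v) * a + v * b"

definition weighted_geom_mean :: "real \<Rightarrow> real \<Rightarrow> real \<Rightarrow> real"
    ("(_ \<sharp>\<^bsub>_\<^esub> _)" [71, 0, 71] 70)
  where "a \<sharp>\<^bsub>v\<^esub> b = a powr (1 - v) * b powr v"

definition arith_mean :: "real \<Rightarrow> real \<Rightarrow> real"  (infix "\<nabla>" 70)
  where "a \<nabla> b = (a + b) / 2"

definition geom_mean :: "real \<Rightarrow> real \<Rightarrow> real"  (infix "\<sharp>" 70)
  where "a \<sharp> b = sqrt (a * b)"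

text \<open>The first three branches are the limit values; the generic formulas, which divide by
  \<open>v\<close>, \<open>1 - v\<close> and \<open>ln a - ln b\<close> (resp. \<open>b - a\<close>), are used only for
  \<open>0 < v < 1\<close> and \<open>a \<noteq> b\<close>. All means are intended for positive \<open>a\<close>, \<open>b\<close>
  and \<open>v \<in> {0..1}\<close>.\<close>

definition weighted_log_mean :: "real \<Rightarrow> real \<Rightarrow> real \<Rightarrow> real"
  where "weighted_log_mean v a b =
    (if v = 0 then a
     else if v = 1 then b
     else if a = b then a
     else 1 / (ln a - ln b) *
       ((1 - v) / v * (a - a powr (1 - v) * b powr v)
        + v / (1 - v) * (a powr (1 - v) * b powr v - b)))"

definition weighted_identric_mean :: "real \<Rightarrow> real \<Rightarrow> real \<Rightarrow> real"
  where "weighted_identric_mean v a b =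
    (if v = 0 then a
     else if v = 1 then b
     else if a = b then a
     else 1 / exp 1 *
       (a \<nabla>\<^bsub>v\<^esub> b) powr ((1 - 2 * v) * (a \<nabla>\<^bsub>v\<^esub> b) / (v * (1 - v) * (b - a))) *
       (b powr (v * b / (1 - v)) / a powr ((1 - v) * a / v)) powr (1 / (b - a)))"

end

theory Submission
  imports Defs "HOL-Analysis.Convex"
begin

text \<open>For \<open>0 < v < 1\<close> put \<open>G = a \<sharp>\<^bsub>v\<^esub> b\<close> and
  \<open>A = a \<nabla>\<^bsub>v\<^esub> b\<close>. With \<open>L\<close> and \<open>I\<close> the classical logarithmic and identric
  means, \<open>L\<^sub>v(a,b)\<close> is the weighted arithmetic mean of \<open>L(a,G)\<close> and \<open>L(G,b)\<close>, and
  \<open>I\<^sub>v(a,b)\<close> is the weighted geometric mean of \<open>I(a,A)\<close> and \<open>I(A,b)\<close>. The inner inequalities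
  thus follow from the classical ones, which place \<open>L(p,q)\<close> and \<open>I(p,q)\<close> between the geometric and
  the arithmetic mean of \<open>p\<close> and \<open>q\<close>; the outer ones are weighted AM-GM.\<close>

section \<open>Classical bounds for the logarithmic and identric means\<close>

lemma ln_upper_bound_geom:
  fixes s :: real
  assumes "1 \<le> s"
  shows "2 * ln s \<le> s - 1 / s"
proof -
  \<comment> \<open>The gap vanishes at \<open>1\<close> and its derivative is a perfect square.
    With \<open>s = sqrt (p / q)\<close> the bound says that the geometric mean is at most the
    logarithmic mean.\<close>
  let ?f = "\<lambda>s::real. s - 1 / s - 2 * ln s"
  have "?f 1 \<le> ?f s"
  proof (rule DERIV_nonneg_imp_nondecreasing[OF assms])
    fix x :: real assume x: "1 \<le> x"
    have "(?f has_real_derivative (1 - 1 / x)\<^sup>2) (at x)"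
      using x by (auto intro!: derivative_eq_intros simp: field_simps power2_eq_square)
    then show "\<exists>y. (?f has_real_derivative y) (at x) \<and> 0 \<le> y" by fastforce
  qed
  then show ?thesis by simp
qed

text \<open>The gap vanishes at \<open>1\<close> and its derivative is a square over a positive
  term. At \<open>s = p / q\<close> this is the bound of the logarithmic mean by the arithmetic
  mean.\<close>

lemma ln_lower_bound_arith:
  fixes s :: real
  assumes "1 \<le> s"
  shows "2 * (s - 1) / (s + 1) \<le> ln s"
proof -
  let ?f = "\<lambda>s::real. ln s - 2 * (s - 1) / (s + 1)"
  have "?f 1 \<le> ?f s"
  proof (rule DERIV_nonneg_imp_nondecreasing[OF assms])
    fix x :: real assume x: "1 \<le> x"
    have "(?f has_real_derivative 1 / x - 4 / (x + 1)\<^sup>2) (at x)"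
      using x by (auto intro!: derivative_eq_intros simp: power2_eq_square)
    moreover have "1 / x - 4 / (x + 1)\<^sup>2 = (x - 1)\<^sup>2 / (x * (x + 1)\<^sup>2)"
      using x by (simp add: divide_simps) (simp add: power2_eq_square algebra_simps)
    moreover have "0 \<le> (x - 1)\<^sup>2 / (x * (x + 1)\<^sup>2)" using x by simp
    ultimately show "\<exists>y. (?f has_real_derivative y) (at x) \<and> 0 \<le> y" by metis
  qed
  then show ?thesis by simp
qed

text \<open>The gap has derivative \<open>- ln (1 - x^2)\<close>, which is nonnegative. This is the
  bound of the identric mean by the arithmetic mean, normalised to the arguments
  \<open>1 - u\<close> and \<open>1 + u\<close> with midpoint \<open>1\<close>.\<close>

lemma x_ln_x_symmetric_difference_le:
  fixes u :: real
  assumes "0 \<le> u" "u < 1"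
  shows "(1 + u) * ln (1 + u) - (1 - u) * ln (1 - u) \<le> 2 * u"
proof -
  let ?f = "\<lambda>u::real. 2 * u - (1 + u) * ln (1 + u) + (1 - u) * ln (1 - u)"
  have "?f 0 \<le> ?f u"
  proof (rule DERIV_nonneg_imp_nondecreasing[OF assms(1)])
    fix x :: real assume "0 \<le> x" "x \<le> u"
    then have x: "0 \<le> x" "x < 1" using assms by auto
    have "(?f has_real_derivative - ln (1 + x) - ln (1 - x)) (at x)"
      using x by (auto intro!: derivative_eq_intros)
    moreover have "ln (1 + x) + ln (1 - x) \<le> 0"
      using x ln_le_minus_one[of "1 + x"] ln_le_minus_one[of "1 - x"] by simp
    ultimately show "\<exists>y. (?f has_real_derivative y) (at x) \<and> 0 \<le> y" by fastforce
  qed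
  then show ?thesis by simp
qed

lemma log_mean_bounds:
  fixes p q :: real
  assumes "0 < p" "0 < q" "p \<noteq> q"
  shows "sqrt (p * q) \<le> (p - q) / (ln p - ln q)"
    and "(p - q) / (ln p - ln q) \<le> (p + q) / 2"
proof -
  have *: "sqrt (p * q) \<le> (p - q) / (ln p - ln q) \<and> (p - q) / (ln p - ln q) \<le> (p + q) / 2"
    if "0 < q" "q < p" for p q :: real
  proof -
    \<comment> \<open>This choice makes \<open>sqrt (p * q) = q * s\<close> and
      \<open>ln p - ln q = 2 * ln s\<close>, so the lower bound is
      \<open>ln_upper_bound_geom\<close> scaled by \<open>q * s\<close>.\<close>
    define s where "s = sqrt (p / q)"
    have s: "1 \<le> s" "0 < s" and s2: "p / q = s\<^sup>2" using that by (auto simp: s_def)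
    have p: "p = q * s\<^sup>2" using s2 that by (simp add: field_simps)
    have pos: "0 < ln p - ln q" using that by simp
    have l: "ln p - ln q = 2 * ln s" using s that by (simp add: p ln_mult ln_realpow)
    have "sqrt (p * q) = q * s"
      using s that by (intro real_sqrt_unique) (auto simp: p power2_eq_square)
    then have "sqrt (p * q) * (ln p - ln q) = q * s * (2 * ln s)" by (simp add: l)
    also have "\<dots> \<le> q * s * (s - 1 / s)"
      using ln_upper_bound_geom[OF s(1)] s that by (intro mult_left_mono) auto
    also have "\<dots> = p - q" using s by (simp add: p field_simps power2_eq_square)
    finally have 1: "sqrt (p * q) \<le> (p - q) / (ln p - ln q)" using pos by (simp add: field_simps)
    have "2 * (p / q - 1) / (p / q + 1) \<le> ln (p / q)"
      using that by (intro ln_lower_bound_arith) simp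
    moreover have "2 * (p / q - 1) / (p / q + 1) = 2 * (p - q) / (p + q)"
      using that by (simp add: divide_simps)
    ultimately have "2 * (p - q) / (p + q) \<le> ln p - ln q" using that by (simp add: ln_div)
    then have "(p - q) / (ln p - ln q) \<le> (p + q) / 2"
      using pos that by (simp add: field_simps)
    with 1 show ?thesis by blast
  qed
  have "sqrt (p * q) \<le> (p - q) / (ln p - ln q) \<and> (p - q) / (ln p - ln q) \<le> (p + q) / 2"
  proof (cases "q < p")
    case True
    then show ?thesis using * assms by blast
  next
    case False
    have "(p - q) / (ln p - ln q) = (q - p) / (ln q - ln p)"
      by (metis minus_diff_eq minus_divide_divide)
    then show ?thesis using *[of p q] False assms by (simp add: mult.commute add.commute)
  qed
  then show "sqrt (p * q) \<le> (p - q) / (ln p - ln q)"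
    and "(p - q) / (ln p - ln q) \<le> (p + q) / 2" by auto
qed

text \<open>The middle term is the logarithm of the identric mean. The lower bound, multiplied out,
  is the inequality between the logarithmic and arithmetic means; the upper bound comes from
  \<open>x_ln_x_symmetric_difference_le\<close>.\<close>

lemma ln_identric_mean_bounds:
  fixes p q :: real
  assumes "0 < p" "0 < q" "p \<noteq> q"
  shows "(ln p + ln q) / 2 \<le> (q * ln q - p * ln p) / (q - p) - 1"
    and "(q * ln q - p * ln p) / (q - p) - 1 \<le> ln ((p + q) / 2)"
proof -
  have *: "(ln p + ln q) / 2 \<le> (q * ln q - p * ln p) / (q - p) - 1 \<and>
      (q * ln q - p * ln p) / (q - p) - 1 \<le> ln ((p + q) / 2)"
    if "0 < p" "p < q" for p q :: real
  proof -
    have pos: "0 < ln q - ln p" using that by simp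
    have "(q - p) / (ln q - ln p) \<le> (q + p) / 2"
      using log_mean_bounds(2)[of q p] that by simp
    then have "2 * (q - p) \<le> (q + p) * (ln q - ln p)" using pos by (simp add: field_simps)
    then have 1: "(ln p + ln q) / 2 \<le> (q * ln q - p * ln p) / (q - p) - 1"
      using that by (simp add: field_simps)
    \<comment> \<open>Midpoint and relative half-distance: the part in \<open>ln m\<close> splits
      off, leaving an inequality in \<open>u\<close> alone.\<close>
    define m u where "m = (p + q) / 2" and "u = (q - p) / (p + q)"
    have u: "0 \<le> u" "0 < u" "u < 1" and m: "0 < m" using that by (auto simp: u_def m_def)
    have pm: "p = m * (1 - u)" and qm: "q = m * (1 + u)"
      using that by (auto simp: u_def m_def field_simps)
    have lnp: "ln p = ln m + ln (1 - u)" and lnq: "ln q = ln m + ln (1 + u)"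
      using u m by (simp_all add: pm qm ln_mult)
    have "q * ln q - p * ln p
        = m * (2 * u * ln m + ((1 + u) * ln (1 + u) - (1 - u) * ln (1 - u)))"
      using lnp lnq by (simp add: pm qm algebra_simps)
    also have "\<dots> \<le> m * (2 * u * ln m + 2 * u)"
      using x_ln_x_symmetric_difference_le[OF u(1,3)] m by (intro mult_left_mono) auto
    also have "\<dots> = (q - p) * (ln m + 1)" by (simp add: pm qm algebra_simps)
    finally have "(q * ln q - p * ln p) / (q - p) - 1 \<le> ln m" using that by (simp add: field_simps)
    with 1 show ?thesis by (simp add: m_def)
  qed
  have "(ln p + ln q) / 2 \<le> (q * ln q - p * ln p) / (q - p) - 1 \<and>
      (q * ln q - p * ln p) / (q - p) - 1 \<le> ln ((p + q) / 2)"
  proof (cases "p < q")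
    case True
    then show ?thesis using * assms by blast
  next
    case False
    have "(q * ln q - p * ln p) / (q - p) = (p * ln p - q * ln q) / (p - q)"
      by (metis minus_diff_eq minus_divide_divide)
    then show ?thesis using *[of q p] False assms by (simp add: add.commute)
  qed
  then show "(ln p + ln q) / 2 \<le> (q * ln q - p * ln p) / (q - p) - 1"
    and "(q * ln q - p * ln p) / (q - p) - 1 \<le> ln ((p + q) / 2)" by auto
qed

section \<open>Weighted AM-GM and the splitting of the weighted means\<close>

lemma weighted_geom_le_arith:
  assumes "0 < a" "0 < b" "0 \<le> v" "v \<le> 1"
  shows "a \<sharp>\<^bsub>v\<^esub> b \<le> a \<nabla>\<^bsub>v\<^esub> b"
  using Youngs_inequality_0[of "1 - v" v a b] assms
  by (simp add: weighted_geom_mean_def weighted_arith_mean_def)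

lemma weighted_geom_mean_pos: "0 < a \<Longrightarrow> 0 < b \<Longrightarrow> 0 < a \<sharp>\<^bsub>v\<^esub> b"
  by (simp add: weighted_geom_mean_def)

lemma weighted_arith_mean_pos:
  assumes "0 < a" "0 < b" "0 \<le> v" "v \<le> 1"
  shows "0 < a \<nabla>\<^bsub>v\<^esub> b"
  using weighted_geom_le_arith[OF assms] weighted_geom_mean_pos[OF assms(1,2), of v] by linarith

lemma ln_weighted_geom_mean:
  "0 < a \<Longrightarrow> 0 < b \<Longrightarrow> ln (a \<sharp>\<^bsub>v\<^esub> b) = ln a \<nabla>\<^bsub>v\<^esub> ln b"
  by (simp add: weighted_geom_mean_def weighted_arith_mean_def ln_mult)

lemma ln_geom_mean: "0 < a \<Longrightarrow> 0 < b \<Longrightarrow> ln (a \<sharp> b) = (ln a + ln b) / 2"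
  by (simp add: geom_mean_def ln_sqrt ln_mult)

lemma geom_mean_pos: "0 < a \<Longrightarrow> 0 < b \<Longrightarrow> 0 < a \<sharp> b"
  by (simp add: geom_mean_def)

text \<open>On the logarithmic scale \<open>G\<close> cuts the segment from \<open>a\<close> to
  \<open>b\<close> in the ratio \<open>v : 1 - v\<close>. The denominators thus contribute
  \<open>1 / v\<close> and \<open>1 / (1 - v)\<close>, which the outer weights turn into the
  coefficients of the definition.\<close>

lemma weighted_log_mean_split:
  fixes a b v :: real
  assumes "0 < a" "0 < b" "a \<noteq> b" "0 < v" "v < 1"
  defines "G \<equiv> a \<sharp>\<^bsub>v\<^esub> b"
  shows "weighted_log_mean v a b = ((a - G) / (ln a - ln G)) \<nabla>\<^bsub>v\<^esub> ((G - b) / (ln G - ln b))"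
proof -
  have "ln a - ln G = v * (ln a - ln b)" "ln G - ln b = (1 - v) * (ln a - ln b)"
    using assms by (simp_all add: ln_weighted_geom_mean weighted_arith_mean_def algebra_simps)
  moreover have "weighted_log_mean v a b
      = 1 / (ln a - ln b) * ((1 - v) / v * (a - G) + v / (1 - v) * (G - b))"
    using assms by (simp add: weighted_log_mean_def weighted_geom_mean_def)
  moreover have "ln a - ln b \<noteq> 0" using assms by simp
  ultimately show ?thesis
    using assms(4,5) by (simp add: weighted_arith_mean_def divide_simps) (simp add: mult_ac)
qed

lemma weighted_identric_mean_pos:
  assumes "0 < a" "0 < b" "0 \<le> v" "v \<le> 1"
  shows "0 < weighted_identric_mean v a b"
  using assms weighted_arith_mean_pos[OF assms] by (simp add: weighted_identric_mean_def)

text \<open>Here \<open>A\<close> cuts the segment from \<open>a\<close> to \<open>b\<close> itself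
  in the ratio \<open>v : 1 - v\<close>. The exponent of \<open>A\<close> in the definition comes
  from \<open>(1 - v) / v - v / (1 - v) = (1 - 2 * v) / (v * (1 - v))\<close>.\<close>

lemma ln_weighted_identric_mean_split:
  fixes a b v :: real
  assumes "0 < a" "0 < b" "a \<noteq> b" "0 < v" "v < 1"
  defines "A \<equiv> a \<nabla>\<^bsub>v\<^esub> b"
  shows "ln (weighted_identric_mean v a b)
    = ((A * ln A - a * ln a) / (A - a) - 1) \<nabla>\<^bsub>v\<^esub> ((b * ln b - A * ln A) / (b - A) - 1)"
proof -
  have A: "0 < A" using assms weighted_arith_mean_pos by auto
  have d: "A - a = v * (b - a)" "b - A = (1 - v) * (b - a)"
    by (simp_all add: A_def weighted_arith_mean_def algebra_simps)
  have "ln (weighted_identric_mean v a b)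
      = (1 - 2 * v) * A / (v * (1 - v) * (b - a)) * ln A - 1
        + 1 / (b - a) * (v * b / (1 - v) * ln b - (1 - v) * a / v * ln a)"
    using assms(1-5) A
    by (simp add: weighted_identric_mean_def A_def[symmetric] ln_mult ln_div)
  also have "\<dots> = ((A * ln A - a * ln a) / (v * (b - a)) - 1)
      \<nabla>\<^bsub>v\<^esub> ((b * ln b - A * ln A) / ((1 - v) * (b - a)) - 1)"
  proof -
    \<comment> \<open>Hiding the logarithmic products leaves a purely rational identity.\<close>
    define x y z c where "x = A * ln A" and "y = a * ln a" and "z = b * ln b" and "c = b - a"
    have "c \<noteq> 0" using assms by (simp add: c_def)
    then have "(1 - 2 * v) / (v * (1 - v) * c) * x - 1 + 1 / c * (v / (1 - v) * z - (1 - v) / v * y)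
       = ((x - y) / (v * c) - 1) \<nabla>\<^bsub>v\<^esub> ((z - x) / ((1 - v) * c) - 1)"
      using assms(4,5) by (simp add: weighted_arith_mean_def divide_simps) algebra
    then show ?thesis by (simp add: x_def y_def z_def c_def mult.assoc)
  qed
  finally show ?thesis by (simp only: d)
qed

lemma weighted_arith_mean_mono:
  assumes "x \<le> x'" "y \<le> y'" "0 \<le> v" "v \<le> 1"
  shows "x \<nabla>\<^bsub>v\<^esub> y \<le> x' \<nabla>\<^bsub>v\<^esub> y'"
  using assms by (simp add: weighted_arith_mean_def add_mono mult_left_mono)

section \<open>Assembly of the two chains\<close>

theorem theorem2p2:
  fixes a b v :: real
  assumes "a > 0" and "b > 0" and "0 \<le> v" and "v \<le> 1"
  shows "(a \<sharp>\<^bsub>v\<^esub> b \<le> (a \<sharp>\<^bsub>v / 2\<^esub> b) \<nabla>\<^bsub>v\<^esub> (a \<sharp>\<^bsub>(1 + v) / 2\<^esub> b)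
        \<and> (a \<sharp>\<^bsub>v / 2\<^esub> b) \<nabla>\<^bsub>v\<^esub> (a \<sharp>\<^bsub>(1 + v) / 2\<^esub> b) \<le> weighted_log_mean v a b
        \<and> weighted_log_mean v a b \<le> (a \<sharp>\<^bsub>v\<^esub> b) \<nabla> (a \<nabla>\<^bsub>v\<^esub> b)
        \<and> (a \<sharp>\<^bsub>v\<^esub> b) \<nabla> (a \<nabla>\<^bsub>v\<^esub> b) \<le> a \<nabla>\<^bsub>v\<^esub> b)
      \<and> (a \<sharp>\<^bsub>v\<^esub> b \<le> (a \<nabla>\<^bsub>v\<^esub> b) \<sharp> (a \<sharp>\<^bsub>v\<^esub> b)
        \<and> (a \<nabla>\<^bsub>v\<^esub> b) \<sharp> (a \<sharp>\<^bsub>v\<^esub> b) \<le> weighted_identric_mean v a b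
        \<and> weighted_identric_mean v a b \<le> (a \<nabla>\<^bsub>v / 2\<^esub> b) \<sharp>\<^bsub>v\<^esub> (a \<nabla>\<^bsub>(1 + v) / 2\<^esub> b)
        \<and> (a \<nabla>\<^bsub>v / 2\<^esub> b) \<sharp>\<^bsub>v\<^esub> (a \<nabla>\<^bsub>(1 + v) / 2\<^esub> b) \<le> a \<nabla>\<^bsub>v\<^esub> b)"
proof -
  define G A where "G = a \<sharp>\<^bsub>v\<^esub> b" and "A = a \<nabla>\<^bsub>v\<^esub> b"
  define g1 g2 where "g1 = a \<sharp>\<^bsub>v / 2\<^esub> b" and "g2 = a \<sharp>\<^bsub>(1 + v) / 2\<^esub> b"
  define m1 m2 where "m1 = a \<nabla>\<^bsub>v / 2\<^esub> b" and "m2 = a \<nabla>\<^bsub>(1 + v) / 2\<^esub> b"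
  note ab = assms(1,2) and v = assms(3,4)
  have G: "0 < G" and g: "0 < g1" "0 < g2"
    using ab by (simp_all add: G_def g1_def g2_def weighted_geom_mean_pos)
  have A: "0 < A" and m: "0 < m1" "0 < m2"
    using ab v by (simp_all add: A_def m1_def m2_def weighted_arith_mean_pos)
  have GA: "G \<le> A" unfolding G_def A_def by (rule weighted_geom_le_arith[OF assms])
  have lnG: "ln G = (1 - v) * ln a + v * ln b"
    using ab by (simp add: G_def ln_weighted_geom_mean weighted_arith_mean_def)
  \<comment> \<open>The exponents of \<open>b\<close> combine to
    \<open>(1 - v) * v / 2 + v * (1 + v) / 2 = v\<close>, so the first inequality is weighted AM-GM
    for \<open>g1\<close> and \<open>g2\<close>. The same identity of weights gives \<open>A\<close>
    from \<open>m1\<close> and \<open>m2\<close>.\<close>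
  have "ln (g1 \<sharp>\<^bsub>v\<^esub> g2) = ln G"
    using ab g unfolding lnG ln_weighted_geom_mean[OF g]
    unfolding g1_def g2_def ln_weighted_geom_mean[OF ab]
    by (simp add: weighted_arith_mean_def field_simps)
  then have "g1 \<sharp>\<^bsub>v\<^esub> g2 = G" using G g weighted_geom_mean_pos by simp
  then have L1: "G \<le> g1 \<nabla>\<^bsub>v\<^esub> g2"
    using weighted_geom_le_arith[OF g v] by simp
  have "m1 \<nabla>\<^bsub>v\<^esub> m2 = A"
    by (simp add: m1_def m2_def A_def weighted_arith_mean_def field_simps)
  then have I4: "m1 \<sharp>\<^bsub>v\<^esub> m2 \<le> A" using weighted_geom_le_arith[OF m v] by simp
  have L4: "G \<nabla> A \<le> A" using GA by (simp add: arith_mean_def)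
  have "ln G \<le> ln A" using GA G A by simp
  then have I1: "G \<le> A \<sharp> G"
    by (subst ln_le_cancel_iff[symmetric]) (simp_all add: G A geom_mean_pos ln_geom_mean)
  have mid: "g1 \<nabla>\<^bsub>v\<^esub> g2 \<le> weighted_log_mean v a b \<and> weighted_log_mean v a b \<le> G \<nabla> A
    \<and> A \<sharp> G \<le> weighted_identric_mean v a b \<and> weighted_identric_mean v a b \<le> m1 \<sharp>\<^bsub>v\<^esub> m2"
  proof -
    consider "v = 0 \<or> v = 1 \<or> a = b" | "0 < v" "v < 1" "a \<noteq> b" using v by force
    then show ?thesis
    proof cases
      case 1
      \<comment> \<open>In the degenerate cases every term between \<open>G\<close> and
        \<open>A\<close> in both chains collapses to this limit value.\<close>
      define c where "c = (if v = 1 then b else a)"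
      have A_eq: "A = c" using 1 by (auto simp: A_def c_def weighted_arith_mean_def algebra_simps)
      have c: "weighted_log_mean v a b = c" "weighted_identric_mean v a b = c"
        using 1 by (auto simp: weighted_log_mean_def weighted_identric_mean_def c_def)
      have "0 < c" using ab by (simp add: c_def)
      have "ln G = ln c" unfolding lnG c_def using 1 by (auto simp: algebra_simps)
      then have G_eq: "G = c" using G \<open>0 < c\<close> by simp
      have "g1 \<nabla>\<^bsub>v\<^esub> g2 = c"
        using 1 ab by (auto simp: g1_def g2_def m1_def m2_def c_def weighted_geom_mean_def weighted_arith_mean_def powr_add[symmetric] algebra_simps add_divide_distrib)
      moreover have "m1 \<sharp>\<^bsub>v\<^esub> m2 = c"
        using 1 ab by (auto simp: g1_def g2_def m1_def m2_def c_def weighted_geom_mean_def weighted_arith_mean_def powr_add[symmetric] algebra_simps add_divide_distrib)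
      ultimately show ?thesis
        using \<open>0 < c\<close> by (simp add: c A_eq G_eq arith_mean_def geom_mean_def)
    next
      case 2
      have "ln a \<noteq> ln b" using 2 ab by simp
      have "ln a - ln G = v * (ln a - ln b)" "ln G - ln b = (1 - v) * (ln a - ln b)"
        by (simp_all add: lnG algebra_simps)
      \<comment> \<open>The classical bounds need distinct arguments on each of the two
        pieces.\<close>
      then have ne: "a \<noteq> G" "G \<noteq> b" using \<open>ln a \<noteq> ln b\<close> 2 by auto
      have "A - a = v * (b - a)" "b - A = (1 - v) * (b - a)"
        by (simp_all add: A_def weighted_arith_mean_def algebra_simps)
      then have neA: "a \<noteq> A" "A \<noteq> b" using 2 by auto
      \<comment> \<open>Halving each piece on the logarithmic scale gives the weights
        \<open>v / 2\<close> and \<open>(1 + v) / 2\<close>.\<close>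
      have "ln (sqrt (a * G)) = ln g1"
        using ab G by (simp add: ln_sqrt ln_mult lnG g1_def ln_weighted_geom_mean
            weighted_arith_mean_def field_simps)
      then have s1: "sqrt (a * G) = g1" using ab G g by simp
      have "ln (sqrt (G * b)) = ln g2"
        using ab G by (simp add: ln_sqrt ln_mult lnG g2_def ln_weighted_geom_mean
            weighted_arith_mean_def field_simps)
      then have s2: "sqrt (G * b) = g2" using ab G g by simp
      note L = weighted_log_mean_split[OF ab 2(3,1,2), folded G_def]
      have L2: "g1 \<nabla>\<^bsub>v\<^esub> g2 \<le> weighted_log_mean v a b"
        unfolding L s1[symmetric] s2[symmetric]
        using ab G ne v by (intro weighted_arith_mean_mono log_mean_bounds)
      have "weighted_log_mean v a b \<le> ((a + G) / 2) \<nabla>\<^bsub>v\<^esub> ((G + b) / 2)"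
        unfolding L using ab G ne v by (intro weighted_arith_mean_mono log_mean_bounds)
      also have "\<dots> = G \<nabla> A"
        by (simp add: A_def weighted_arith_mean_def arith_mean_def field_simps)
      finally have L3: "weighted_log_mean v a b \<le> G \<nabla> A" .
      note I = ln_weighted_identric_mean_split[OF ab 2(3,1,2), folded A_def]
      \<comment> \<open>The comparison is made between logarithms, where weighted geometric means
        become weighted arithmetic ones and monotonicity applies piece by piece.\<close>
      have "ln (A \<sharp> G) = ((ln a + ln A) / 2) \<nabla>\<^bsub>v\<^esub> ((ln A + ln b) / 2)"
        using A G by (simp add: ln_geom_mean lnG weighted_arith_mean_def field_simps)
      also have "\<dots> \<le> ln (weighted_identric_mean v a b)"
        unfolding I using ab A neA v by (intro weighted_arith_mean_mono ln_identric_mean_bounds)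
      finally have I2: "A \<sharp> G \<le> weighted_identric_mean v a b"
        using A G assms by (simp add: geom_mean_pos weighted_identric_mean_pos)
      have "(a + A) / 2 = m1" "(A + b) / 2 = m2"
        by (simp_all add: A_def m1_def m2_def weighted_arith_mean_def field_simps)
      then have "ln (m1 \<sharp>\<^bsub>v\<^esub> m2) = ln ((a + A) / 2) \<nabla>\<^bsub>v\<^esub> ln ((A + b) / 2)"
        using m by (simp add: ln_weighted_geom_mean)
      also have "\<dots> \<ge> ln (weighted_identric_mean v a b)"
        unfolding I using ab A neA v by (intro weighted_arith_mean_mono ln_identric_mean_bounds)
      finally have I3: "weighted_identric_mean v a b \<le> m1 \<sharp>\<^bsub>v\<^esub> m2"
        using m assms by (simp add: weighted_geom_mean_pos weighted_identric_mean_pos)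
      show ?thesis using L2 L3 I2 I3 by blast
    qed
  qed
  show ?thesis using L1 L4 I1 I4 mid unfolding G_def A_def g1_def g2_def m1_def m2_def by blast
qed

end
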